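(* There is a family of normal, graded vector configurations $\{\mathcal A^d\subset\mathbb Z^d : d\ge 11\}$, with $\dim(\mathcal A^d)=d$, such that for every $d\ge11$ the configuration $\mathcal A^d$ is not $\Delta$-normal for any regular triangulation $\Delta$ of $\mathcal A^d$.
   Context: Let $\mathbb K$ be a field, $\mathbb N=\{0,1,2,\dots\}$, and $\mathcal A=\{\mathbf a_1,\dots,\mathbf a_n\}\subset\mathbb Z^d$ a finite vector configuration. The toric ideal of $\mathcal A$ is $I_{\mathcal A}=\langle \mathbf x^{\mathbf u}-\mathbf x^{\mathbf v} : \mathbf u,\mathbf v\in\mathbb N^n,\ \sum_i u_i\mathbf a_i=\sum_i v_i\mathbf a_i\rangle\subseteq R=\mathbb K[x_1,\dots,x_n]$. $cone(\mathcal A)$, $\mathbb Z\mathcal A$, $\mathbb N\mathcal A$ are the sets of $\mathbb R_{\ge0}$-, $\mathbb Z$-, $\mathbb N$-linear combinations of $\mathcal A$. $\dim(\mathcal A)$ is the rank of $\mathbb Z\mathcal A$; it is assumed to be $d$. $\mathcal A$ is normal if $\mathbb N\mathcal A=cone(\mathcal A)\cap\mathbb Z\mathcal A$, and graded if it spans an affine hyperplane in $\mathbb R^d$. For $\tau\subseteq[n]=\{1,\dots,n\}$ put $\mathcal A_\tau=\{\mathbf a_i: i\in\tau\}$. A pure $(d-1)$-dimensional simplicial complex $\Delta$ on $[n]$ (not every element of $[n]$ need be used), with set of facets ($d$-element faces) $\max\Delta$, is a triangulation of $\mathcal A$ if $cone(\mathcal A)=\bigcup_{\sigma\in\max\Delta}cone(\mathcal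 A_\sigma)$ and $cone(\mathcal A_{\sigma})\cap cone(\mathcal A_{\sigma'})=cone(\mathcal A_{\sigma\cap\sigma'})$ for all $\sigma,\sigma'\in\max\Delta$. The Stanley-Reisner ideal of $\Delta$ is $\langle\prod_{i\in\tau}x_i:\tau\notin\Delta\rangle$. The radical of any monomial initial ideal of $I_{\mathcal A}$ is the Stanley-Reisner ideal of a triangulation of $\mathcal A$ (a theorem of Sturmfels); triangulations arising in this way are called regular. $\mathcal A$ is $\Delta$-normal if $\Delta$ is a regular triangulation of $\mathcal A$ such that for each $\sigma\in\max\Delta$, $\mathcal A\cap cone(\mathcal A_\sigma)$ is a Hilbert basis of $cone(\mathcal A_\sigma)\cap\mathbb Z\mathcal A$, i.e. $\mathbb N(\mathcal A\cap cone(\mathcal A_\sigma))=cone(\mathcal A_\sigma)\cap\mathbb Z\mathcal A$. *)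

theory Defs
  imports "HOL-Analysis.Analysis" "HOL-Analysis.Finite_Function_Topology" "HOL-Algebra.Ideal"
begin

section \<open>Vector configurations\<close>

text \<open>
  The dimension \<open>d\<close> varies inside the statement, so $\mathbb{R}^d$ is the subspace of those
  finitely supported vectors, of type \<open>nat \<Rightarrow>\<^sub>0 real\<close>, whose support lies in \<open>{1..d}\<close>.
  The lattice $\mathbb{Z}^d$ is the set of its points with integer coordinates.
  A configuration $\{a_1,\dots,a_n\}$ is given by \<open>n\<close> and a function \<open>a\<close>, of which only the
  values on \<open>{1..n}\<close> matter.
\<close>

definition real_space :: "nat \<Rightarrow> (nat \<Rightarrow>\<^sub>0 real) set" where
  "real_space d = {x. Poly_Mapping.keys x \<subseteq> {1..d}}"

definition int_lattice :: "nat \<Rightarrow> (nat \<Rightarrow>\<^sub>0 real) set" where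
  "int_lattice d = {x \<in> real_space d. \<forall>k. Poly_Mapping.lookup x k \<in> \<int>}"

definition vector_config :: "nat \<Rightarrow> nat \<Rightarrow> (nat \<Rightarrow> nat \<Rightarrow>\<^sub>0 real) \<Rightarrow> bool" where
  "vector_config d n a \<longleftrightarrow> a ` {1..n} \<subseteq> int_lattice d \<and> inj_on a {1..n}"

text \<open>Linear combinations of a finite set \<open>S\<close> with coefficients in \<open>C\<close>.\<close>

definition lin_combs :: "real set \<Rightarrow> (nat \<Rightarrow>\<^sub>0 real) set \<Rightarrow> (nat \<Rightarrow>\<^sub>0 real) set" where
  "lin_combs C S = {\<Sum>v\<in>S. c v *\<^sub>R v | c. \<forall>v\<in>S. c v \<in> C}"

abbreviation cone_of :: "(nat \<Rightarrow>\<^sub>0 real) set \<Rightarrow> (nat \<Rightarrow>\<^sub>0 real) set" where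
  "cone_of S \<equiv> lin_combs {0..} S"

abbreviation Z_combs :: "(nat \<Rightarrow>\<^sub>0 real) set \<Rightarrow> (nat \<Rightarrow>\<^sub>0 real) set" where
  "Z_combs S \<equiv> lin_combs \<int> S"

abbreviation N_combs :: "(nat \<Rightarrow>\<^sub>0 real) set \<Rightarrow> (nat \<Rightarrow>\<^sub>0 real) set" where
  "N_combs S \<equiv> lin_combs \<nat> S"

text \<open>
  The rank of the lattice generated by the configuration.  As this lattice lies in
  $\mathbb{Z}^d$, its rank is the dimension of its real span.
\<close>

definition config_dim :: "nat \<Rightarrow> (nat \<Rightarrow> nat \<Rightarrow>\<^sub>0 real) \<Rightarrow> nat" where
  "config_dim n a = dim (Z_combs (a ` {1..n}))"

definition normal_config :: "nat \<Rightarrow> (nat \<Rightarrow> nat \<Rightarrow>\<^sub>0 real) \<Rightarrow> bool" where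
  "normal_config n a \<longleftrightarrow>
     N_combs (a ` {1..n}) = cone_of (a ` {1..n}) \<inter> Z_combs (a ` {1..n})"

definition affine_hyperplane :: "nat \<Rightarrow> (nat \<Rightarrow>\<^sub>0 real) set \<Rightarrow> bool" where
  "affine_hyperplane d H \<longleftrightarrow>
     (\<exists>(c :: nat \<Rightarrow> real) b. (\<exists>k\<in>{1..d}. c k \<noteq> 0) \<and>
        H = {x \<in> real_space d. (\<Sum>k=1..d. c k * Poly_Mapping.lookup x k) = b})"

definition graded_config :: "nat \<Rightarrow> nat \<Rightarrow> (nat \<Rightarrow> nat \<Rightarrow>\<^sub>0 real) \<Rightarrow> bool" where
  "graded_config d n a \<longleftrightarrow> affine_hyperplane d (affine hull (a ` {1..n}))"


section \<open>Toric ideals and their initial ideals\<close>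

text \<open>
  A monomial $x^u$ is identified with its exponent vector \<open>u :: nat \<Rightarrow>\<^sub>0 nat\<close>, and a polynomial
  with its finitely supported coefficient function; the type class operations on
  \<open>(nat \<Rightarrow>\<^sub>0 nat) \<Rightarrow>\<^sub>0 'k\<close> are those of the polynomial ring in the variables $x_i$, $i \in \mathbb{N}$.
  The ring \<open>poly_ring n\<close> is its subring $K[x_1,\dots,x_n]$.
\<close>

type_synonym 'k mpoly = "(nat \<Rightarrow>\<^sub>0 nat) \<Rightarrow>\<^sub>0 'k"

definition exponents :: "nat \<Rightarrow> (nat \<Rightarrow>\<^sub>0 nat) set" where
  "exponents n = {u. Poly_Mapping.keys u \<subseteq> {1..n}}"

definition poly_ring :: "nat \<Rightarrow> ('k::field) mpoly ring" where
  "poly_ring n = \<lparr>carrier = {f. Poly_Mapping.keys f \<subseteq> exponents n},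
     monoid.mult = (*), one = 1, zero = 0, add = (+)\<rparr>"

definition mon :: "(nat \<Rightarrow>\<^sub>0 nat) \<Rightarrow> ('k::field) mpoly" where
  "mon u = Poly_Mapping.single u 1"

definition var :: "nat \<Rightarrow> ('k::field) mpoly" where
  "var i = mon (Poly_Mapping.single i 1)"

definition toric_ideal :: "nat \<Rightarrow> (nat \<Rightarrow> nat \<Rightarrow>\<^sub>0 real) \<Rightarrow> ('k::field) mpoly set" where
  "toric_ideal n a = genideal (poly_ring n)
     {mon u - mon v | u v. u \<in> exponents n \<and> v \<in> exponents n \<and>
        (\<Sum>i=1..n. real (Poly_Mapping.lookup u i) *\<^sub>R a i) =
        (\<Sum>i=1..n. real (Poly_Mapping.lookup v i) *\<^sub>R a i)}"

text \<open>In a term order \<open>r\<close>, \<open>(u, v) \<in> r\<close> means that $x^u$ is less than or equal to $x^v$.\<close>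

definition term_order :: "nat \<Rightarrow> (nat \<Rightarrow>\<^sub>0 nat) rel \<Rightarrow> bool" where
  "term_order n r \<longleftrightarrow> linear_order_on (exponents n) r \<and>
     (\<forall>u\<in>exponents n. (0, u) \<in> r) \<and>
     (\<forall>u v w. (u, v) \<in> r \<and> w \<in> exponents n \<longrightarrow> (u + w, v + w) \<in> r)"

text \<open>The ideal generated by the leading monomials of the nonzero elements of \<open>I\<close>.\<close>

definition initial_ideal ::
    "nat \<Rightarrow> (nat \<Rightarrow>\<^sub>0 nat) rel \<Rightarrow> ('k::field) mpoly set \<Rightarrow> 'k mpoly set" where
  "initial_ideal n r I = genideal (poly_ring n)
     {mon u | u. \<exists>f\<in>I. u \<in> Poly_Mapping.keys f \<and> (\<forall>v\<in>Poly_Mapping.keys f. (v, u) \<in> r)}"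

definition radical_ideal :: "nat \<Rightarrow> ('k::field) mpoly set \<Rightarrow> 'k mpoly set" where
  "radical_ideal n I = {f \<in> carrier (poly_ring n). \<exists>k::nat. f ^ k \<in> I}"


section \<open>Triangulations\<close>

definition facets :: "nat set set \<Rightarrow> nat set set" where
  "facets \<Delta> = {\<sigma>\<in>\<Delta>. \<forall>\<tau>\<in>\<Delta>. \<sigma> \<subseteq> \<tau> \<longrightarrow> \<tau> = \<sigma>}"

text \<open>Abstract simplicial complexes on \<open>{1..n}\<close> all of whose facets have \<open>d\<close> elements;
  an element of \<open>{1..n}\<close> need not be a vertex.\<close>

definition pure_complex :: "nat \<Rightarrow> nat \<Rightarrow> nat set set \<Rightarrow> bool" where
  "pure_complex d n \<Delta> \<longleftrightarrow> {} \<in> \<Delta> \<and> \<Delta> \<subseteq> Pow {1..n} \<and>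
     (\<forall>\<sigma>\<in>\<Delta>. \<forall>\<tau>. \<tau> \<subseteq> \<sigma> \<longrightarrow> \<tau> \<in> \<Delta>) \<and> (\<forall>\<sigma>\<in>facets \<Delta>. card \<sigma> = d)"

definition triangulation ::
    "nat \<Rightarrow> nat \<Rightarrow> (nat \<Rightarrow> nat \<Rightarrow>\<^sub>0 real) \<Rightarrow> nat set set \<Rightarrow> bool" where
  "triangulation d n a \<Delta> \<longleftrightarrow> pure_complex d n \<Delta> \<and>
     cone_of (a ` {1..n}) = (\<Union>\<sigma>\<in>facets \<Delta>. cone_of (a ` \<sigma>)) \<and>
     (\<forall>\<sigma>\<in>facets \<Delta>. \<forall>\<sigma>'\<in>facets \<Delta>.
        cone_of (a ` \<sigma>) \<inter> cone_of (a ` \<sigma>') = cone_of (a ` (\<sigma> \<inter> \<sigma>')))"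

definition SR_ideal :: "nat \<Rightarrow> nat set set \<Rightarrow> ('k::field) mpoly set" where
  "SR_ideal n \<Delta> = genideal (poly_ring n) {\<Prod>i\<in>\<tau>. var i | \<tau>. \<tau> \<subseteq> {1..n} \<and> \<tau> \<notin> \<Delta>}"

text \<open>The coefficient field \<open>'k\<close> does not occur in the other arguments and is passed
  as a type argument.\<close>

definition regular_triangulation ::
    "('k::field) itself \<Rightarrow> nat \<Rightarrow> nat \<Rightarrow> (nat \<Rightarrow> nat \<Rightarrow>\<^sub>0 real) \<Rightarrow> nat set set \<Rightarrow> bool" where
  "regular_triangulation K d n a \<Delta> \<longleftrightarrow> triangulation d n a \<Delta> \<and>
     (\<exists>r. term_order n r \<and>
        radical_ideal n (initial_ideal n r (toric_ideal n a)) = (SR_ideal n \<Delta> :: 'k mpoly set))"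

definition delta_normal ::
    "('k::field) itself \<Rightarrow> nat \<Rightarrow> nat \<Rightarrow> (nat \<Rightarrow> nat \<Rightarrow>\<^sub>0 real) \<Rightarrow> nat set set \<Rightarrow> bool" where
  "delta_normal K d n a \<Delta> \<longleftrightarrow> regular_triangulation K d n a \<Delta> \<and>
     (\<forall>\<sigma>\<in>facets \<Delta>. N_combs (a ` {1..n} \<inter> cone_of (a ` \<sigma>)) =
        cone_of (a ` \<sigma>) \<inter> Z_combs (a ` {1..n}))"

end

theory Submission
  imports Defs
begin

text \<open>
  The example is the six-dimensional cone of Bruns, Gubeladze, Henk, Martin and Weismantel that
  violates the integral Caratheodory property, enlarged by free coordinates.  In suitable
  coordinates its ten generators are $e_1, \dots, e_5$ and $e_6 + e_{j-1} + e_{j+1} - e_j$, where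
  $j$ runs cyclically over $1, \dots, 5$.

  Every generator spans an extreme ray, so if the configuration were $\Delta$-normal, every lattice
  point of a cone $\sigma$ of $\Delta$ would be an $\mathbb{N}$-combination of the $d$ generators of
  $\sigma$ alone.  But every $\mathbb{N}$-representation of $(4,4,4,4,4,9,1,\dots,1)$ uses all the
  $d - 6$ added unit vectors and at least seven of the first ten generators.

  Normality amounts to a rounding statement: if $s_{j-1} + s_{j+1} - s_j \le b_j$ has a nonnegative
  real solution $s$ with integral coordinate sum $t$, then it has a nonnegative integral one with
  the same sum.  Subtracting integral parts reduces it to $0 \le s_j < 1$, where $t \le 4$, and
  for each $t$ a few candidates suffice.
\<close>

section \<open>Integral rounding in the unit cube, with indices modulo 5\<close>

text \<open>If \<open>b1\<close> and \<open>b2\<close> were at most 0, adding the first two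
  inequalities would give \<open>f3 + f5 \<le> 0\<close>. Then \<open>f3 = f5 = 0\<close> and
  \<open>f1 + f2 + f4 = 3\<close>, impossible for numbers below 1.\<close>

lemma unit_cube_sum_three_bounds:
  fixes f1 f2 f3 f4 f5 :: real and b1 b2 b3 b5 :: int
  assumes f: "0 \<le> f1" "f1 < 1" "0 \<le> f2" "f2 < 1" "0 \<le> f3" "f3 < 1" "0 \<le> f4" "f4 < 1" "0 \<le> f5" "f5 < 1"
    and t: "f1 + f2 + f3 + f4 + f5 = 3"
    and b: "f5 + f2 - f1 \<le> of_int b1" "f1 + f3 - f2 \<le> of_int b2" "f2 + f4 - f3 \<le> of_int b3"
      "f4 + f1 - f5 \<le> of_int b5"
  shows "1 \<le> b1 \<or> 1 \<le> b2 \<or> 2 \<le> b3 \<and> 2 \<le> b5"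
proof (rule ccontr)
  assume *: "\<not> ?thesis"
  then have "real_of_int b1 \<le> 0" "real_of_int b2 \<le> 0" by linarith+
  moreover from * have "real_of_int b3 \<le> 1 \<or> real_of_int b5 \<le> 1" by auto
  ultimately show False using f t b by (elim disjE) linarith+
qed

lemma unit_cube_rounding:
  fixes f1 f2 f3 f4 f5 :: real and b1 b2 b3 b4 b5 :: int
  assumes f: "0 \<le> f1" "f1 < 1" "0 \<le> f2" "f2 < 1" "0 \<le> f3" "f3 < 1" "0 \<le> f4" "f4 < 1" "0 \<le> f5" "f5 < 1"
    and t: "f1 + f2 + f3 + f4 + f5 = of_int t"
    and b: "f5 + f2 - f1 \<le> of_int b1" "f1 + f3 - f2 \<le> of_int b2" "f2 + f4 - f3 \<le> of_int b3"
      "f3 + f5 - f4 \<le> of_int b4" "f4 + f1 - f5 \<le> of_int b5"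
  obtains s1 s2 s3 s4 s5 :: int where "0 \<le> s1" "0 \<le> s2" "0 \<le> s3" "0 \<le> s4" "0 \<le> s5"
    "s1 + s2 + s3 + s4 + s5 = t" "s5 + s2 - s1 \<le> b1" "s1 + s3 - s2 \<le> b2" "s2 + s4 - s3 \<le> b3"
    "s3 + s5 - s4 \<le> b4" "s4 + s1 - s5 \<le> b5"
proof -
  have t_range: "t = 0 \<or> t = 1 \<or> t = 2 \<or> t = 3 \<or> t = 4" using f t by linarith
  \<comment> \<open>Each left-hand side in \<open>b\<close> exceeds -1, so an integer above it is at
    least 0.\<close>
  have b0: "0 \<le> b1" "0 \<le> b2" "0 \<le> b3" "0 \<le> b4" "0 \<le> b5"
    using f b by linarith+
  \<comment> \<open>Suppose three cyclically consecutive bounds are 0. Adding adjacent inequalities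
    kills four of the five fractions, an outer inequality kills the remaining one, and
    \<open>t = 0\<close>.\<close>
  have small: "0 < t \<Longrightarrow> 1 \<le> b1 \<or> 1 \<le> b2 \<or> 1 \<le> b3"
     "0 < t \<Longrightarrow> 1 \<le> b2 \<or> 1 \<le> b3 \<or> 1 \<le> b4"
     "0 < t \<Longrightarrow> 1 \<le> b3 \<or> 1 \<le> b4 \<or> 1 \<le> b5"
     "0 < t \<Longrightarrow> 1 \<le> b4 \<or> 1 \<le> b5 \<or> 1 \<le> b1"
     "0 < t \<Longrightarrow> 1 \<le> b5 \<or> 1 \<le> b1 \<or> 1 \<le> b2"
    using f t b by (smt (verit) of_int_0_less_iff of_int_le_0_iff)+
  \<comment> \<open>The indices with bound at least 1 meet every cyclic triple, so two of them are
    at distance 2.\<close>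
  have pair: "(1 \<le> b1 \<and> 1 \<le> b3) \<or> (1 \<le> b2 \<and> 1 \<le> b4) \<or> (1 \<le> b3 \<and> 1 \<le> b5) \<or>
        (1 \<le> b4 \<and> 1 \<le> b1) \<or> (1 \<le> b5 \<and> 1 \<le> b2)" if "0 < t"
    using small[OF that] by blast
  from t_range consider "t = 0" | "t = 1" | "t = 2" | "t = 3" | "t = 4" by blast
  then show ?thesis
  proof cases
    case 1
    then show ?thesis using b0 by (intro that[of 0 0 0 0 0]) auto
  next
    case 2
    with pair have "(1 \<le> b1 \<and> 1 \<le> b3) \<or> (1 \<le> b2 \<and> 1 \<le> b4) \<or> (1 \<le> b3 \<and> 1 \<le> b5) \<or>
        (1 \<le> b4 \<and> 1 \<le> b1) \<or> (1 \<le> b5 \<and> 1 \<le> b2)" by simp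
    \<comment> \<open>The candidate is the unit vector at the index between the two with positive
      bound.\<close>
    then show ?thesis
      by (elim disjE conjE)
        ((rule that[of 0 1 0 0 0]; use b0 2 in simp),
         (rule that[of 0 0 1 0 0]; use b0 2 in simp),
         (rule that[of 0 0 0 1 0]; use b0 2 in simp),
         (rule that[of 0 0 0 0 1]; use b0 2 in simp),
         (rule that[of 1 0 0 0 0]; use b0 2 in simp))
  next
    case 3
    with pair have "(1 \<le> b1 \<and> 1 \<le> b3) \<or> (1 \<le> b2 \<and> 1 \<le> b4) \<or> (1 \<le> b3 \<and> 1 \<le> b5) \<or>
        (1 \<le> b4 \<and> 1 \<le> b1) \<or> (1 \<le> b5 \<and> 1 \<le> b2)" by simp
    \<comment> \<open>The candidate has its two ones at the adjacent indices on the far side of the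
      pair, away from the index between.\<close>
    then show ?thesis
      by (elim disjE conjE)
        ((rule that[of 0 0 0 1 1]; use b0 3 in simp),
         (rule that[of 1 0 0 0 1]; use b0 3 in simp),
         (rule that[of 1 1 0 0 0]; use b0 3 in simp),
         (rule that[of 0 1 1 0 0]; use b0 3 in simp),
         (rule that[of 0 0 1 1 0]; use b0 3 in simp))
  next
    case 4
    have r0: "1 \<le> b1 \<or> 1 \<le> b2 \<or> 2 \<le> b3 \<and> 2 \<le> b5"
      using f t b 4 by (intro unit_cube_sum_three_bounds[of f1 f2 f3 f4 f5]) linarith+
    have r1: "1 \<le> b2 \<or> 1 \<le> b3 \<or> 2 \<le> b4 \<and> 2 \<le> b1"
      using f t b 4 by (intro unit_cube_sum_three_bounds[of f2 f3 f4 f5 f1]) linarith+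
    have r2: "1 \<le> b3 \<or> 1 \<le> b4 \<or> 2 \<le> b5 \<and> 2 \<le> b2"
      using f t b 4 by (intro unit_cube_sum_three_bounds[of f3 f4 f5 f1 f2]) linarith+
    have r3: "1 \<le> b4 \<or> 1 \<le> b5 \<or> 2 \<le> b1 \<and> 2 \<le> b3"
      using f t b 4 by (intro unit_cube_sum_three_bounds[of f4 f5 f1 f2 f3]) linarith+
    have r4: "1 \<le> b5 \<or> 1 \<le> b1 \<or> 2 \<le> b2 \<and> 2 \<le> b4"
      using f t b 4 by (intro unit_cube_sum_three_bounds[of f5 f1 f2 f3 f4]) linarith+
    \<comment> \<open>Unless a pair of bounds at least 2 occurs, the indices with bound at least 1
      cover all edges of the 5-cycle. Such a cover contains some j, j + 1, j + 3.\<close>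
    from r0 r1 r2 r3 r4 have "(2 \<le> b3 \<and> 2 \<le> b5) \<or> (2 \<le> b4 \<and> 2 \<le> b1) \<or> (2 \<le> b5 \<and> 2 \<le> b2) \<or> (2 \<le> b1 \<and> 2 \<le> b3) \<or>
       (2 \<le> b2 \<and> 2 \<le> b4) \<or> (1 \<le> b1 \<and> 1 \<le> b2 \<and> 1 \<le> b4) \<or> (1 \<le> b2 \<and> 1 \<le> b3 \<and> 1 \<le> b5) \<or>
       (1 \<le> b3 \<and> 1 \<le> b4 \<and> 1 \<le> b1) \<or> (1 \<le> b4 \<and> 1 \<le> b5 \<and> 1 \<le> b2) \<or> (1 \<le> b5 \<and> 1 \<le> b1 \<and> 1 \<le> b3)"
      by blast
    \<comment> \<open>The candidates are 0-1 vectors with two zeros: at the two indices with bound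
      at least 2, or at the adjacent indices j, j + 1 of the cover.\<close>
    then show ?thesis
      by (elim disjE conjE)
        ((rule that[of 1 1 0 1 0]; use b0 4 in simp),
         (rule that[of 0 1 1 0 1]; use b0 4 in simp),
         (rule that[of 1 0 1 1 0]; use b0 4 in simp),
         (rule that[of 0 1 0 1 1]; use b0 4 in simp),
         (rule that[of 1 0 1 0 1]; use b0 4 in simp),
         (rule that[of 0 0 1 1 1]; use b0 4 in simp),
         (rule that[of 1 0 0 1 1]; use b0 4 in simp),
         (rule that[of 1 1 0 0 1]; use b0 4 in simp),
         (rule that[of 1 1 1 0 0]; use b0 4 in simp),
         (rule that[of 0 1 1 1 0]; use b0 4 in simp))
  next
    case 5
    have "1 \<le> b1" "1 \<le> b2" "1 \<le> b3" "1 \<le> b4" "1 \<le> b5"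
      using f t b 5 by linarith+
    \<comment> \<open>If all bounds equal 1, a 0-1 vector of sum 4 violates the inequality at its
      zero entry; hence the entry 2.\<close>
    then show ?thesis
      using that[of 1 0 0 1 2] 5 by simp
  qed 
qed

section \<open>The configuration and its linear combinations in coordinates\<close>

definition basis_vec :: "nat \<Rightarrow> nat \<Rightarrow>\<^sub>0 real" where
  "basis_vec k = Poly_Mapping.single k 1"

text \<open>Ten generators live in the first six coordinates, so the free unit vectors are shifted
  by 4 and dimension \<open>d\<close> takes the indices up to \<open>d + 4\<close>.\<close>

definition gen :: "nat \<Rightarrow> nat \<Rightarrow>\<^sub>0 real" where
  "gen i =
    (if i \<le> 5 then basis_vec i
     else if i = 6 then basis_vec 6 + basis_vec 5 + basis_vec 2 - basis_vec 1
     else if i = 7 then basis_vec 6 + basis_vec 1 + basis_vec 3 - basis_vec 2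
     else if i = 8 then basis_vec 6 + basis_vec 2 + basis_vec 4 - basis_vec 3
     else if i = 9 then basis_vec 6 + basis_vec 3 + basis_vec 5 - basis_vec 4
     else if i = 10 then basis_vec 6 + basis_vec 4 + basis_vec 1 - basis_vec 5
     else basis_vec (i - 4))"

lemma lookup_scaleR: "Poly_Mapping.lookup (r *\<^sub>R x) k = r *\<^sub>R Poly_Mapping.lookup x k"
  for x :: "'a \<Rightarrow>\<^sub>0 'b :: real_vector"
proof -
  have "finite {i. r *\<^sub>R Poly_Mapping.lookup x i \<noteq> 0}"
    by (rule finite_subset[OF _ finite_lookup[of x]]) auto
  then show ?thesis by (simp add: scaleR_poly_mapping_def)
qed

lemma lookup_basis_vec: "Poly_Mapping.lookup (basis_vec j) k = (if j = k then 1 else 0)"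
  by (simp add: basis_vec_def lookup_single when_def)

lemmas lookup_simps = lookup_sum lookup_scaleR lookup_add lookup_minus lookup_basis_vec

text \<open>Coefficients are attached to indices, whereas \<open>lin_combs\<close> attaches them to
  vectors; injectivity of \<open>gen\<close> reconciles the two.\<close>

definition comb :: "nat \<Rightarrow> (nat \<Rightarrow> real) \<Rightarrow> nat \<Rightarrow>\<^sub>0 real" where
  "comb d c = (\<Sum>i = 1..d + 4. c i *\<^sub>R gen i)"

text \<open>This reduces later questions about combinations to linear arithmetic in the
  coefficients.\<close>

lemma lookup_comb:
  assumes "6 \<le> d"
  shows "Poly_Mapping.lookup (comb d c) k =
    (if k = 1 then c 1 + (c 10 + c 7 - c 6)
     else if k = 2 then c 2 + (c 6 + c 8 - c 7)
     else if k = 3 then c 3 + (c 7 + c 9 - c 8)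
     else if k = 4 then c 4 + (c 8 + c 10 - c 9)
     else if k = 5 then c 5 + (c 9 + c 6 - c 10)
     else if k = 6 then c 6 + c 7 + c 8 + c 9 + c 10
     else if k \<in> {7..d} then c (k + 4) else 0)"
proof -
  let ?L = "\<lambda>i. c i * Poly_Mapping.lookup (gen i) k"
  have "{1..d + 4} = {1..10} \<union> {11..d + 4}" using assms by auto
  then have "Poly_Mapping.lookup (comb d c) k = sum ?L {1..10} + sum ?L {11..d + 4}"
    by (simp add: comb_def lookup_simps sum.union_disjoint)
  also have "sum ?L {11..d + 4} = (\<Sum>i = 11..d + 4. if i = k + 4 then c i else 0)"
    by (intro sum.cong) (auto simp: gen_def lookup_simps)
  also have "\<dots> = (if k \<in> {7..d} then c (k + 4) else 0)"
    by (simp add: sum.delta)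
  also have "{1..10::nat} = {1, 2, 3, 4, 5, 6, 7, 8, 9, 10}" by (rule Set.set_eqI, simp, presburger)
  finally have *: "Poly_Mapping.lookup (comb d c) k =
      sum ?L {1, 2, 3, 4, 5, 6, 7, 8, 9, 10} + (if k \<in> {7..d} then c (k + 4) else 0)" .
  have "k \<le> 6 \<longleftrightarrow> k \<in> {0, 1, 2, 3, 4, 5, 6}" by auto
  then consider "k = 0" | "k = 1" | "k = 2" | "k = 3" | "k = 4" | "k = 5" | "k = 6" | "7 \<le> k"
    by fastforce
  then show ?thesis
    unfolding * by cases (simp_all add: gen_def lookup_simps)
qed

lemma comb_in_real_space:
  assumes "6 \<le> d"
  shows "comb d c \<in> real_space d"
  using assms by (auto simp: real_space_def in_keys_iff lookup_comb[OF assms] split: if_splits)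

lemma comb_indicator:
  assumes "i \<in> {1..d + 4}"
  shows "comb d (\<lambda>j. if j = i then r else 0) = r *\<^sub>R gen i"
proof -
  have "comb d (\<lambda>j. if j = i then r else 0) = (\<Sum>j = 1..d + 4. if j = i then r *\<^sub>R gen i else 0)"
    unfolding comb_def by (intro sum.cong) auto
  then show ?thesis using assms by simp
qed

text \<open>For \<open>i \<le> 5\<close> the sixth coordinate is 0, which kills \<open>c 6\<close>
  to \<open>c 10\<close>. For \<open>i\<close> from 6 to 10, coordinate \<open>i - 5\<close> is -1
  and only \<open>c i\<close> enters it negatively. For larger \<open>i\<close>, coordinate
  \<open>i - 4\<close> is \<open>c i\<close> alone.\<close>

lemma gen_extreme:
  assumes d: "6 \<le> d" and c: "\<forall>j\<in>{1..d + 4}. 0 \<le> c j" and i: "i \<in> {1..d + 4}" and eq: "comb d c = gen i"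
  shows "0 < c i"
proof -
  have nn: "0 \<le> c 1" "0 \<le> c 2" "0 \<le> c 3" "0 \<le> c 4" "0 \<le> c 5"
      "0 \<le> c 6" "0 \<le> c 7" "0 \<le> c 8" "0 \<le> c 9" "0 \<le> c 10"
    using c d by auto
  note l = arg_cong[OF eq, of "\<lambda>x. Poly_Mapping.lookup x k" for k, unfolded lookup_comb[OF d]]
  have "i \<le> 5 \<longleftrightarrow> i \<in> {1, 2, 3, 4, 5}" "i \<le> 10 \<longleftrightarrow> i \<le> 5 \<or> i \<in> {6, 7, 8, 9, 10}"
    using i by auto
  then consider "i \<in> {1, 2, 3, 4, 5}" | "i \<in> {6, 7, 8, 9, 10}" | "11 \<le> i" by linarith
  then show ?thesis
  proof cases
    case 1
    then have "c 6 + c 7 + c 8 + c 9 + c 10 = 0"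
      using l[of 6] by (auto simp: gen_def lookup_simps)
    then have "c 6 = 0" "c 7 = 0" "c 8 = 0" "c 9 = 0" "c 10 = 0"
      using nn by linarith+
    then show ?thesis using 1 l[of i] by (auto simp: gen_def lookup_simps)
  next
    case 2
    then show ?thesis using l[of "i - 5"] nn by (auto simp: gen_def lookup_simps)
  next
    case 3
    then have "i = (i - 11) + 11" by simp
    then obtain k where "i = k + 11" by blast
    then show ?thesis using l[of "k + 7"] i by (auto simp: gen_def lookup_simps add.commute)
  qed
qed

lemma inj_on_gen:
  assumes "6 \<le> d"
  shows "inj_on gen {1..d + 4}"
proof (rule inj_onI)
  fix i j assume i: "i \<in> {1..d + 4}" and j: "j \<in> {1..d + 4}" and eq: "gen i = gen j"
  \<comment> \<open>The indicator of \<open>j\<close> represents \<open>gen j = gen i\<close>, so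
    extremality makes it positive at \<open>i\<close>.\<close>
  have "0 < (if i = j then 1 else 0 :: real)"
    by (rule gen_extreme[OF assms _ i, where c = "\<lambda>i. if i = j then 1 else 0"]) (simp_all add: comb_indicator[OF j] eq)
  then show "i = j" by (simp split: if_splits)
qed

lemma lin_combs_image:
  assumes "inj_on a I"
  shows "lin_combs C (a ` I) = {\<Sum>i\<in>I. c i *\<^sub>R a i | c. \<forall>i\<in>I. c i \<in> C}"
proof safe
  fix x assume "x \<in> lin_combs C (a ` I)"
  then obtain c where "x = (\<Sum>v\<in>a ` I. c v *\<^sub>R v)" "\<forall>v\<in>a ` I. c v \<in> C"
    unfolding lin_combs_def by auto
  then show "\<exists>c. x = (\<Sum>i\<in>I. c i *\<^sub>R a i) \<and> (\<forall>i\<in>I. c i \<in> C)"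
    by (intro exI[of _ "c \<circ> a"]) (simp add: sum.reindex[OF assms])
next
  fix c assume "\<forall>i\<in>I. c i \<in> C"
  then show "(\<Sum>i\<in>I. c i *\<^sub>R a i) \<in> lin_combs C (a ` I)"
    unfolding lin_combs_def using assms
    by (intro CollectI exI[of _ "c \<circ> the_inv_into I a"])
       (simp add: sum.reindex the_inv_into_f_f)
qed

text \<open>Extending coefficients by zero lets \<open>lookup_comb\<close> apply to the cone of a
  facet as well.\<close>

lemma lin_combs_subset_gen:
  assumes "6 \<le> d" "\<sigma> \<subseteq> {1..d + 4}" "0 \<in> C"
  shows "lin_combs C (gen ` \<sigma>) = {comb d c | c. (\<forall>i\<in>{1..d + 4}. c i \<in> C) \<and> (\<forall>i. i \<notin> \<sigma> \<longrightarrow> c i = 0)}"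
    (is "_ = ?R")
proof -
  have inj: "inj_on gen \<sigma>" using inj_on_gen[OF assms(1)] assms(2) by (rule inj_on_subset)
  have "lin_combs C (gen ` \<sigma>) \<subseteq> ?R"
  proof
    fix x assume "x \<in> lin_combs C (gen ` \<sigma>)"
    then obtain c where c: "x = (\<Sum>i\<in>\<sigma>. c i *\<^sub>R gen i)" "\<forall>i\<in>\<sigma>. c i \<in> C"
      unfolding lin_combs_image[OF inj] by blast
    then have "x = comb d (\<lambda>i. if i \<in> \<sigma> then c i else 0)"
      unfolding comb_def using assms(2) by (auto intro!: sum.mono_neutral_cong_left)
    then show "x \<in> ?R" using c(2) assms(3) by force
  qed
  moreover have "?R \<subseteq> lin_combs C (gen ` \<sigma>)"
  proof safe
    fix c assume c: "\<forall>i\<in>{1..d + 4}. c i \<in> C" "\<forall>i. i \<notin> \<sigma> \<longrightarrow> c i = 0"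
    have "comb d c = (\<Sum>i\<in>\<sigma>. c i *\<^sub>R gen i)"
      unfolding comb_def using assms(2) c(2) by (intro sum.mono_neutral_right) auto
    then show "comb d c \<in> lin_combs C (gen ` \<sigma>)"
      unfolding lin_combs_image[OF inj] using c(1) assms(2) by blast
  qed
  ultimately show ?thesis by blast
qed

lemma lin_combs_gen:
  assumes "6 \<le> d"
  shows "lin_combs C (gen ` {1..d + 4}) = {comb d c | c. \<forall>i\<in>{1..d + 4}. c i \<in> C}"
  unfolding lin_combs_image[OF inj_on_gen[OF assms]] comb_def ..

section \<open>Lattice, dimension and grading\<close>

lemma vector_config_gen:
  assumes "6 \<le> d"
  shows "vector_config d (d + 4) gen"
proof -
  have "gen i \<in> int_lattice d" if i: "i \<in> {1..d + 4}" for i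
  proof -
    have eq: "gen i = comb d (\<lambda>j. if j = i then 1 else 0)" using comb_indicator[OF i] by simp
    note g = arg_cong[OF eq, of "\<lambda>x. Poly_Mapping.lookup x k" for k, unfolded lookup_comb[OF assms]]
    have "Poly_Mapping.lookup (gen i) k \<in> \<int>" for k
      unfolding g by auto
    with comb_in_real_space[OF assms] eq show ?thesis by (simp add: int_lattice_def)
  qed
  with inj_on_gen[OF assms] show ?thesis by (auto simp: vector_config_def)
qed

lemma real_space_expand:
  assumes "x \<in> real_space d"
  shows "x = (\<Sum>k = 1..d. Poly_Mapping.lookup x k *\<^sub>R basis_vec k)"
proof (rule poly_mapping_eqI)
  fix k
  have "(\<Sum>j = 1..d. Poly_Mapping.lookup x j * (if j = k then 1 else 0)) =
      (\<Sum>j = 1..d. if j = k then Poly_Mapping.lookup x j else 0)"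
    by (intro sum.cong) auto
  moreover have "Poly_Mapping.lookup x k = 0" if "k \<notin> {1..d}"
    using assms that by (auto simp: real_space_def in_keys_iff)
  ultimately show "Poly_Mapping.lookup x k =
      Poly_Mapping.lookup (\<Sum>k = 1..d. Poly_Mapping.lookup x k *\<^sub>R basis_vec k) k"
    by (simp add: lookup_simps)
qed

text \<open>The coefficients with respect to the lattice basis formed by \<open>gen 6\<close> and the unit
  vectors other than \<open>basis_vec 6\<close>; it is unimodular because \<open>gen 6\<close> has sixth entry 1.\<close>

definition coords :: "nat \<Rightarrow> (nat \<Rightarrow>\<^sub>0 real) \<Rightarrow> nat \<Rightarrow> real" where
  "coords d x i =
    (let l = Poly_Mapping.lookup x in
     if i = 1 then l 1 + l 6 else if i = 2 then l 2 - l 6 else if i = 5 then l 5 - l 6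
     else if i \<le> 6 then l i else if i \<le> 10 then 0 else l (i - 4))"

lemma comb_coords:
  assumes "6 \<le> d" "x \<in> real_space d"
  shows "comb d (coords d x) = x"
proof (rule poly_mapping_eqI)
  fix k
  have "Poly_Mapping.lookup x k = 0" if "k \<notin> {1..d}"
    using assms that by (auto simp: real_space_def in_keys_iff)
  then show "Poly_Mapping.lookup (comb d (coords d x)) k = Poly_Mapping.lookup x k"
    unfolding lookup_comb[OF assms(1)] by (auto simp: coords_def Let_def)
qed

text \<open>\<open>coords\<close> is integral on integral vectors, so lattice membership becomes
  integrality of the coordinates.\<close>

lemma Z_combs_gen:
  assumes "6 \<le> d"
  shows "Z_combs (gen ` {1..d + 4}) = int_lattice d"
proof (intro subset_antisym subsetI)
  fix x assume "x \<in> Z_combs (gen ` {1..d + 4})"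
  then obtain c where x: "x = comb d c" and c: "\<forall>i\<in>{1..d + 4}. c i \<in> \<int>"
    unfolding lin_combs_gen[OF assms] by blast
  have "Poly_Mapping.lookup x k \<in> \<int>" for k
    unfolding x lookup_comb[OF assms] using c assms by (auto intro!: Ints_add Ints_diff)
  with comb_in_real_space[OF assms] show "x \<in> int_lattice d" by (simp add: int_lattice_def x)
next
  fix x assume x: "x \<in> int_lattice d"
  then have "\<forall>i. coords d x i \<in> \<int>"
    by (auto simp: int_lattice_def coords_def Let_def)
  then show "x \<in> Z_combs (gen ` {1..d + 4})"
    unfolding lin_combs_gen[OF assms] using comb_coords[OF assms] x
    by (auto simp: int_lattice_def intro!: exI[of _ "coords d x"])
qed

lemma config_dim_gen:
  assumes "6 \<le> d"
  shows "config_dim (d + 4) gen = d"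
  unfolding config_dim_def Z_combs_gen[OF assms]
proof (rule dim_unique)
  let ?B = "basis_vec ` {1..d}"
  have inj: "inj_on basis_vec {1..d}"
    by (rule inj_onI) (metis lookup_basis_vec zero_neq_one)
  show "?B \<subseteq> int_lattice d"
    by (auto simp: int_lattice_def real_space_def lookup_basis_vec in_keys_iff split: if_splits)
  show "int_lattice d \<subseteq> span ?B"
  proof
    fix x assume "x \<in> int_lattice d"
    then have "x = (\<Sum>k = 1..d. Poly_Mapping.lookup x k *\<^sub>R basis_vec k)"
      by (intro real_space_expand) (simp add: int_lattice_def)
    also have "\<dots> \<in> span ?B" by (intro span_sum span_scale span_base) auto
    finally show "x \<in> span ?B" .
  qed
  show "independent ?B"
  proof (rule independent_if_scalars_zero)
    fix f x assume 0: "(\<Sum>x\<in>?B. f x *\<^sub>R x) = 0" and "x \<in> ?B"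
    then obtain k where k: "k \<in> {1..d}" "x = basis_vec k" by blast
    have "0 = Poly_Mapping.lookup (\<Sum>x\<in>?B. f x *\<^sub>R x) k" unfolding 0 by simp
    also have "\<dots> = (\<Sum>j = 1..d. f (basis_vec j) * (if j = k then 1 else 0))"
      unfolding sum.reindex[OF inj] by (simp add: lookup_simps)
    also have "\<dots> = (\<Sum>j = 1..d. if j = k then f x else 0)"
      by (intro sum.cong) (auto simp: k)
    also have "\<dots> = f x" using k by simp
    finally show "f x = 0" by simp
  qed simp
  show "card ?B = d" unfolding card_image[OF inj] by simp
qed

lemma affine_hull_image:
  assumes "finite I" "inj_on a I"
  shows "affine hull (a ` I) = {\<Sum>i\<in>I. c i *\<^sub>R a i | c. sum c I = 1}"
proof safe
  fix x assume "x \<in> affine hull (a ` I)"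
  then obtain u where "sum u (a ` I) = 1" "(\<Sum>v\<in>a ` I. u v *\<^sub>R v) = x"
    using assms(1) by (auto simp: affine_hull_finite)
  then show "\<exists>c. x = (\<Sum>i\<in>I. c i *\<^sub>R a i) \<and> sum c I = 1"
    by (intro exI[of _ "u \<circ> a"]) (simp add: sum.reindex[OF assms(2)])
next
  fix c :: "_ \<Rightarrow> real" assume "sum c I = 1"
  then show "(\<Sum>i\<in>I. c i *\<^sub>R a i) \<in> affine hull (a ` I)"
    using assms by (simp add: affine_hull_finite)
      (intro exI[of _ "c \<circ> the_inv_into I a"], simp add: sum.reindex the_inv_into_f_f)
qed

text \<open>Leaving out the sixth coordinate, each generator has coordinate sum 1, namely
  \<open>1 + 1 - 1\<close> for the cyclic ones. This linear form is the grading.\<close>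

lemma degree_comb:
  assumes "6 \<le> d"
  shows "(\<Sum>k = 1..d. (if k = 6 then 0 else 1) * Poly_Mapping.lookup (comb d c) k) = sum c {1..d + 4}"
proof -
  let ?L = "\<lambda>k. (if k = 6 then 0 else 1) * Poly_Mapping.lookup (comb d c) k"
  have "{1..d} = {1..6} \<union> {7..d}" using assms by auto
  then have "sum ?L {1..d} = sum ?L {1..6} + sum ?L {7..d}" by (simp add: sum.union_disjoint)
  also have "sum ?L {7..d} = (\<Sum>k = 7..d. c (k + 4))"
    by (intro sum.cong) (auto simp: lookup_comb[OF assms])
  also have "\<dots> = sum c {11..d + 4}"
    using sum.shift_bounds_cl_nat_ivl[of c 7 4 d] by simp
  also have "{1..6::nat} = {1, 2, 3, 4, 5, 6}" by auto
  also have "sum ?L {1, 2, 3, 4, 5, 6} = sum c {1, 2, 3, 4, 5, 6, 7, 8, 9, 10}"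
    by (simp add: lookup_comb[OF assms])
  also have "{1, 2, 3, 4, 5, 6, 7, 8, 9, 10} = {1..10::nat}" by (rule Set.set_eqI, simp, presburger)
  also have "sum c {1..10} + sum c {11..d + 4} = sum c ({1..10} \<union> {11..d + 4})"
    by (simp add: sum.union_disjoint)
  also have "{1..10} \<union> {11..d + 4} = {1..d + 4}" using assms by auto
  finally show ?thesis .
qed

lemma graded_config_gen:
  assumes "6 \<le> d"
  shows "graded_config d (d + 4) gen"
proof -
  define w :: "nat \<Rightarrow> real" where "w k = (if k = 6 then 0 else 1)" for k
  have deg: "(\<Sum>k = 1..d. w k * Poly_Mapping.lookup (comb d c) k) = sum c {1..d + 4}" for c
    unfolding w_def by (rule degree_comb[OF assms])
  have "affine hull (gen ` {1..d + 4}) = {comb d c | c. sum c {1..d + 4} = 1}"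
    unfolding affine_hull_image[OF finite_atLeastAtMost inj_on_gen[OF assms]] comb_def ..
  also have "\<dots> = {x \<in> real_space d. (\<Sum>k = 1..d. w k * Poly_Mapping.lookup x k) = 1}"
  proof safe
    fix x assume x: "x \<in> real_space d" "(\<Sum>k = 1..d. w k * Poly_Mapping.lookup x k) = 1"
    \<comment> \<open>The form evaluates to the coefficient sum of any representation, so
      \<open>coords\<close> is automatically an affine combination here.\<close>
    then have "sum (coords d x) {1..d + 4} = 1"
      using deg[of "coords d x"] by (simp add: comb_coords[OF assms])
    with comb_coords[OF assms x(1)] show "\<exists>c. x = comb d c \<and> sum c {1..d + 4} = 1" by metis
  qed (use comb_in_real_space[OF assms] deg in simp_all)
  finally show ?thesis
    unfolding graded_config_def affine_hyperplane_def
    using assms by (intro exI[of _ w] exI[of _ 1]) (auto simp: w_def intro: bexI[of _ 1])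
qed

section \<open>Normality\<close>

text \<open>The inequalities have integer coefficients, so removing floors shifts \<open>t\<close>
  and the bounds by integers. Adding the nonnegative floors back afterwards preserves
  nonnegativity.\<close>

lemma lattice_rounding:
  fixes c1 c2 c3 c4 c5 :: real and b1 b2 b3 b4 b5 t :: int
  assumes c: "0 \<le> c1" "0 \<le> c2" "0 \<le> c3" "0 \<le> c4" "0 \<le> c5"
    and t: "c1 + c2 + c3 + c4 + c5 = of_int t"
    and b: "c5 + c2 - c1 \<le> of_int b1" "c1 + c3 - c2 \<le> of_int b2" "c2 + c4 - c3 \<le> of_int b3"
      "c3 + c5 - c4 \<le> of_int b4" "c4 + c1 - c5 \<le> of_int b5"
  obtains s1 s2 s3 s4 s5 :: int where "0 \<le> s1" "0 \<le> s2" "0 \<le> s3" "0 \<le> s4" "0 \<le> s5"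
    "s1 + s2 + s3 + s4 + s5 = t" "s5 + s2 - s1 \<le> b1" "s1 + s3 - s2 \<le> b2" "s2 + s4 - s3 \<le> b3"
    "s3 + s5 - s4 \<le> b4" "s4 + s1 - s5 \<le> b5"
proof -
  define n1 n2 n3 n4 n5 where n: "n1 = \<lfloor>c1\<rfloor>" "n2 = \<lfloor>c2\<rfloor>" "n3 = \<lfloor>c3\<rfloor>" "n4 = \<lfloor>c4\<rfloor>" "n5 = \<lfloor>c5\<rfloor>"
  have n0: "0 \<le> n1" "0 \<le> n2" "0 \<le> n3" "0 \<le> n4" "0 \<le> n5" using c by (simp_all add: n)
  have frac: "0 \<le> c1 - of_int n1" "c1 - of_int n1 < 1" "0 \<le> c2 - of_int n2" "c2 - of_int n2 < 1"
    "0 \<le> c3 - of_int n3" "c3 - of_int n3 < 1" "0 \<le> c4 - of_int n4" "c4 - of_int n4 < 1"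
    "0 \<le> c5 - of_int n5" "c5 - of_int n5 < 1"
    unfolding n by linarith+
  have t': "(c1 - of_int n1) + (c2 - of_int n2) + (c3 - of_int n3) + (c4 - of_int n4) + (c5 - of_int n5) =
      of_int (t - (n1 + n2 + n3 + n4 + n5))"
    using t by simp
  have b': "(c5 - of_int n5) + (c2 - of_int n2) - (c1 - of_int n1) \<le> of_int (b1 - (n5 + n2 - n1))"
    "(c1 - of_int n1) + (c3 - of_int n3) - (c2 - of_int n2) \<le> of_int (b2 - (n1 + n3 - n2))"
    "(c2 - of_int n2) + (c4 - of_int n4) - (c3 - of_int n3) \<le> of_int (b3 - (n2 + n4 - n3))"
    "(c3 - of_int n3) + (c5 - of_int n5) - (c4 - of_int n4) \<le> of_int (b4 - (n3 + n5 - n4))"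
    "(c4 - of_int n4) + (c1 - of_int n1) - (c5 - of_int n5) \<le> of_int (b5 - (n4 + n1 - n5))"
    subgoal using b(1) by simp
    subgoal using b(2) by simp
    subgoal using b(3) by simp
    subgoal using b(4) by simp
    subgoal using b(5) by simp
    done
  obtain s1 s2 s3 s4 s5 where s: "0 \<le> s1" "0 \<le> s2" "0 \<le> s3" "0 \<le> s4" "0 \<le> s5"
    "s1 + s2 + s3 + s4 + s5 = t - (n1 + n2 + n3 + n4 + n5)"
    "s5 + s2 - s1 \<le> b1 - (n5 + n2 - n1)" "s1 + s3 - s2 \<le> b2 - (n1 + n3 - n2)"
    "s2 + s4 - s3 \<le> b3 - (n2 + n4 - n3)" "s3 + s5 - s4 \<le> b4 - (n3 + n5 - n4)"
    "s4 + s1 - s5 \<le> b5 - (n4 + n1 - n5)"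
    by (rule unit_cube_rounding[OF frac t' b'])
  show thesis
    by (rule that[OF add_nonneg_nonneg[OF s(1) n0(1)] add_nonneg_nonneg[OF s(2) n0(2)]
          add_nonneg_nonneg[OF s(3) n0(3)] add_nonneg_nonneg[OF s(4) n0(4)]
          add_nonneg_nonneg[OF s(5) n0(5)]])
      ((use s(6) in simp), (use s(7) in simp), (use s(8) in simp), (use s(9) in simp),
       (use s(10) in simp), (use s(11) in simp))
qed

lemma normal_config_gen:
  assumes d: "6 \<le> d"
  shows "normal_config (d + 4) gen"
proof -
  have "comb d c \<in> N_combs (gen ` {1..d + 4})"
    if c: "\<forall>i\<in>{1..d + 4}. 0 \<le> c i" and int: "comb d c \<in> int_lattice d" for c
  proof -
    have nn: "0 \<le> c 1" "0 \<le> c 2" "0 \<le> c 3" "0 \<le> c 4" "0 \<le> c 5"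
      "0 \<le> c 6" "0 \<le> c 7" "0 \<le> c 8" "0 \<le> c 9" "0 \<le> c 10"
      using c d by auto
    \<comment> \<open>The coordinates are integral already; the floor only moves them to type
      \<open>int\<close>.\<close>
    define b where "b k = \<lfloor>Poly_Mapping.lookup (comb d c) k\<rfloor>" for k
    have b: "of_int (b k) = Poly_Mapping.lookup (comb d c) k" for k
      using int by (auto simp: b_def int_lattice_def elim: Ints_cases)
    note bk = b[unfolded lookup_comb[OF d]]
    obtain s1 s2 s3 s4 s5 where s: "0 \<le> s1" "0 \<le> s2" "0 \<le> s3" "0 \<le> s4" "0 \<le> s5"
      "s1 + s2 + s3 + s4 + s5 = b 6" "s5 + s2 - s1 \<le> b 1" "s1 + s3 - s2 \<le> b 2" "s2 + s4 - s3 \<le> b 3"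
      "s3 + s5 - s4 \<le> b 4" "s4 + s1 - s5 \<le> b 5"
    \<comment> \<open>The real solution consists of the coefficients of \<open>gen 6\<close> to
      \<open>gen 10\<close>. Dropping the nonnegative \<open>c 1\<close> to \<open>c 5\<close> from
      the first five coordinates gives the inequalities.\<close>
    proof (rule lattice_rounding[OF nn(6-10)])
      show "c 6 + c 7 + c 8 + c 9 + c 10 = of_int (b 6)" using bk[of 6] by simp
      show "c 10 + c 7 - c 6 \<le> of_int (b 1)" using bk[of 1] nn(1) by simp
      show "c 6 + c 8 - c 7 \<le> of_int (b 2)" using bk[of 2] nn(2) by simp
      show "c 7 + c 9 - c 8 \<le> of_int (b 3)" using bk[of 3] nn(3) by simp
      show "c 8 + c 10 - c 9 \<le> of_int (b 4)" using bk[of 4] nn(4) by simp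
      show "c 9 + c 6 - c 10 \<le> of_int (b 5)" using bk[of 5] nn(5) by simp
    qed
    \<comment> \<open>The slacks of the five rounded inequalities become the coefficients of
      \<open>gen 1\<close> to \<open>gen 5\<close>.\<close>
    define m where "m i =
      (if i = 1 then b 1 - (s5 + s2 - s1) else if i = 2 then b 2 - (s1 + s3 - s2)
       else if i = 3 then b 3 - (s2 + s4 - s3) else if i = 4 then b 4 - (s3 + s5 - s4)
       else if i = 5 then b 5 - (s4 + s1 - s5) else if i = 6 then s1 else if i = 7 then s2
       else if i = 8 then s3 else if i = 9 then s4 else if i = 10 then s5 else b (i - 4))" for i
    have m: "0 \<le> m i" if i: "i \<in> {1..d + 4}" for i
    proof (cases "11 \<le> i")
      case True
      then have "i = (i - 11) + 11" by simp
      then obtain k where k: "i = k + 11" by blast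
      have "0 \<le> real_of_int (b (k + 7))" using bk[of "k + 7"] c i k by simp
      then show ?thesis by (simp add: m_def k add.commute)
    next
      case False
      with i have "i = 1 \<or> i = 2 \<or> i = 3 \<or> i = 4 \<or> i = 5 \<or> i = 6 \<or> i = 7 \<or> i = 8 \<or> i = 9 \<or> i = 10"
        by simp presburger
      moreover have "0 \<le> m 1" using s(7) by (simp add: m_def)
      moreover have "0 \<le> m 2" using s(8) by (simp add: m_def)
      moreover have "0 \<le> m 3" using s(9) by (simp add: m_def)
      moreover have "0 \<le> m 4" using s(10) by (simp add: m_def)
      moreover have "0 \<le> m 5" using s(11) by (simp add: m_def)
      moreover have "0 \<le> m 6" "0 \<le> m 7" "0 \<le> m 8" "0 \<le> m 9" "0 \<le> m 10"
        using s(1-5) by (simp_all add: m_def)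
      ultimately show ?thesis by (elim disjE) simp_all
    qed
    have "comb d c = comb d (\<lambda>i. of_int (m i))"
    proof (rule poly_mapping_eqI)
      fix k
      have b6: "of_int s1 + of_int s2 + of_int s3 + of_int s4 + of_int s5 = real_of_int (b 6)"
        using s(6) by (metis of_int_add)
      consider "k = 1" | "k = 2" | "k = 3" | "k = 4" | "k = 5" | "k = 6" | "k \<in> {7..d}"
        | "k \<noteq> 1 \<and> k \<noteq> 2 \<and> k \<noteq> 3 \<and> k \<noteq> 4 \<and> k \<noteq> 5 \<and> k \<noteq> 6 \<and> k \<notin> {7..d}"
        by blast
      then have "real_of_int (b k) = Poly_Mapping.lookup (comb d (\<lambda>i. of_int (m i))) k"
      proof cases
        case 7
        then show ?thesis by (simp add: lookup_comb[OF d] m_def)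
      next
        case 8
        then have "real_of_int (b k) = 0" by (auto simp: bk)
        with 8 show ?thesis by (auto simp: lookup_comb[OF d])
      qed (simp_all add: lookup_comb[OF d] m_def b6)
      then show "Poly_Mapping.lookup (comb d c) k =
          Poly_Mapping.lookup (comb d (\<lambda>i. of_int (m i))) k"
        by (simp add: b)
    qed
    moreover have "\<forall>i\<in>{1..d + 4}. real_of_int (m i) \<in> \<nat>"
      using m by (metis of_nat_in_Nats of_int_of_nat_eq nonneg_int_cases)
    ultimately show ?thesis unfolding lin_combs_gen[OF d] by blast
  qed
  then have "cone_of (gen ` {1..d + 4}) \<inter> Z_combs (gen ` {1..d + 4}) \<subseteq> N_combs (gen ` {1..d + 4})"
    unfolding Z_combs_gen[OF d] lin_combs_gen[OF d, of "{0..}"] by auto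
  moreover have "N_combs S \<subseteq> cone_of S \<inter> Z_combs S" for S
    unfolding lin_combs_def using Nats_subset_Ints by (fastforce elim: Nats_cases)
  ultimately show ?thesis unfolding normal_config_def by blast
qed

section \<open>Failure of the Hilbert basis condition\<close>

text \<open>For $v = (4,4,4,4,4,9)$, the coefficients \<open>s1\<close>, ..., \<open>s5\<close> of \<open>gen 6\<close>, ..., \<open>gen 10\<close> have sum 9
  and determine those of \<open>gen 1\<close>, ..., \<open>gen 5\<close>, the first five entries of the list.\<close>

lemma seven_generators_enumeration:
  "\<forall>s1 \<in> set [0..<10]. \<forall>s2 \<in> set [0..<10 - s1]. \<forall>s3 \<in> set [0..<10 - s1 - s2].
   \<forall>s4 \<in> set [0..<10 - s1 - s2 - s3].
     let s5 = 9 - s1 - s2 - s3 - s4 in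
     s5 + s2 \<le> 4 + s1 \<longrightarrow> s1 + s3 \<le> 4 + s2 \<longrightarrow> s2 + s4 \<le> 4 + s3 \<longrightarrow>
     s3 + s5 \<le> 4 + s4 \<longrightarrow> s4 + s1 \<le> 4 + s5 \<longrightarrow>
     6 < length (filter (\<lambda>x::nat. x \<noteq> 0)
       [4 + s1 - (s5 + s2), 4 + s2 - (s1 + s3), 4 + s3 - (s2 + s4),
        4 + s4 - (s3 + s5), 4 + s5 - (s4 + s1), s1, s2, s3, s4, s5])"
  by code_simp

text \<open>The equations avoid subtraction because \<open>m\<close> is natural; they place
  \<open>m 6\<close> to \<open>m 10\<close> in the range of the enumeration and identify its listed
  differences with \<open>m 1\<close> to \<open>m 5\<close>.\<close>

lemma seven_generators:
  fixes m :: "nat \<Rightarrow> nat"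
  assumes eq: "m 1 + (m 10 + m 7) = 4 + m 6" "m 2 + (m 6 + m 8) = 4 + m 7"
    "m 3 + (m 7 + m 9) = 4 + m 8" "m 4 + (m 8 + m 10) = 4 + m 9" "m 5 + (m 9 + m 6) = 4 + m 10"
    "m 6 + m 7 + m 8 + m 9 + m 10 = 9"
  shows "6 < card {i\<in>{1..10}. m i \<noteq> 0}"
proof -
  have "6 < length (filter (\<lambda>x. x \<noteq> 0) (map m [1, 2, 3, 4, 5, 6, 7, 8, 9, 10]))"
  proof -
    have m5: "9 - m 6 - m 7 - m 8 - m 9 = m 10" using eq(6) by simp
    have m1: "4 + m 6 - (m 10 + m 7) = m 1"
      "4 + m 7 - (m 6 + m 8) = m 2"
      "4 + m 8 - (m 7 + m 9) = m 3"
      "4 + m 9 - (m 8 + m 10) = m 4"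
      "4 + m 10 - (m 9 + m 6) = m 5"
      subgoal using eq(1) by simp
      subgoal using eq(2) by simp
      subgoal using eq(3) by simp
      subgoal using eq(4) by simp
      subgoal using eq(5) by simp
      done
    have le: "m 10 + m 7 \<le> 4 + m 6"
      "m 6 + m 8 \<le> 4 + m 7"
      "m 7 + m 9 \<le> 4 + m 8"
      "m 8 + m 10 \<le> 4 + m 9"
      "m 9 + m 6 \<le> 4 + m 10"
      subgoal using eq(1) by simp
      subgoal using eq(2) by simp
      subgoal using eq(3) by simp
      subgoal using eq(4) by simp
      subgoal using eq(5) by simp
      done
    have mem: "m 6 \<in> set [0..<10]" "m 7 \<in> set [0..<10 - m 6]" "m 8 \<in> set [0..<10 - m 6 - m 7]"
      "m 9 \<in> set [0..<10 - m 6 - m 7 - m 8]"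
      unfolding set_upt atLeastLessThan_iff using eq(6) by linarith+
    show ?thesis
      using seven_generators_enumeration[THEN bspec[OF _ mem(1)], THEN bspec[OF _ mem(2)],
        THEN bspec[OF _ mem(3)], THEN bspec[OF _ mem(4)], unfolded Let_def m5 m1] le
      unfolding list.map by blast
  qed
  also have "\<dots> = length (filter (\<lambda>i. m i \<noteq> 0) [1..<11])"
  proof -
    have "[1, 2, 3, 4, 5, 6, 7, 8, 9, 10] = [1..<11::nat]" by (simp add: upt_rec)
    then show ?thesis by (simp only: filter_map length_map o_def)
  qed
  also have "\<dots> = card (set (filter (\<lambda>i. m i \<noteq> 0) [1..<11]))"
    by (rule distinct_card[symmetric]) simp
  also have "set (filter (\<lambda>i. m i \<noteq> 0) [1..<11]) = {i\<in>{1..10}. m i \<noteq> 0}"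
    by auto
  finally show ?thesis .
qed

text \<open>A facet has \<open>d\<close> elements, yet it would have to contain at least seven of
  the first ten indices and all \<open>d - 6\<close> indices from 11 on.\<close>

lemma gen_not_delta_normal:
  assumes d: "6 \<le> d"
  shows "\<not> delta_normal K d (d + 4) gen \<Delta>"
proof (rule notI)
  assume "delta_normal K d (d + 4) gen \<Delta>"
  then have tri: "triangulation d (d + 4) gen \<Delta>"
    and hilb: "\<And>\<sigma>. \<sigma> \<in> facets \<Delta> \<Longrightarrow> N_combs (gen ` {1..d + 4} \<inter> cone_of (gen ` \<sigma>)) =
        cone_of (gen ` \<sigma>) \<inter> Z_combs (gen ` {1..d + 4})"
    by (auto simp: delta_normal_def regular_triangulation_def)
  \<comment> \<open>An explicit positive integral representation of (4,4,4,4,4,9,1,...,1), which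
    puts \<open>v\<close> in the cone and in the lattice at once.\<close>
  define c :: "nat \<Rightarrow> real" where
    "c i = (if i \<in> {2, 8, 9} then 2 else if i \<in> {3, 10} then 3 else if i = 5 then 4 else 1)" for i
  define v where "v = comb d c"
  have "v \<in> cone_of (gen ` {1..d + 4})"
    unfolding lin_combs_gen[OF d] v_def c_def by auto
  then obtain \<sigma> where \<sigma>: "\<sigma> \<in> facets \<Delta>" and v\<sigma>: "v \<in> cone_of (gen ` \<sigma>)"
    using tri by (auto simp: triangulation_def)
  then have sub: "\<sigma> \<subseteq> {1..d + 4}" and card: "card \<sigma> = d"
    using tri by (auto simp: triangulation_def pure_complex_def facets_def)
  have "gen i \<in> gen ` \<sigma>" if i: "i \<in> {1..d + 4}" and cone: "gen i \<in> cone_of (gen ` \<sigma>)" for i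
  proof -
    obtain c' where c': "gen i = comb d c'" "\<forall>j\<in>{1..d + 4}. c' j \<in> {0..}" "\<forall>j. j \<notin> \<sigma> \<longrightarrow> c' j = 0"
      using cone unfolding lin_combs_subset_gen[OF d sub, of "{0..}", simplified] by auto
    have "0 < c' i" by (rule gen_extreme[OF d _ i c'(1)[symmetric]]) (use c'(2) in auto)
    then show ?thesis using c'(3) by force
  qed
  moreover have "gen ` \<sigma> \<subseteq> cone_of (gen ` \<sigma>)"
  proof safe
    fix i assume i: "i \<in> \<sigma>"
    then have "gen i = comb d (\<lambda>j. if j = i then 1 else 0)" using comb_indicator[of i d 1] sub by auto
    then show "gen i \<in> cone_of (gen ` \<sigma>)"
      unfolding lin_combs_subset_gen[OF d sub, of "{0..}", simplified]
      using i by (intro CollectI exI[of _ "\<lambda>j. if j = i then 1 else 0"]) auto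
  qed
  ultimately have "gen ` {1..d + 4} \<inter> cone_of (gen ` \<sigma>) = gen ` \<sigma>" using sub by blast
  moreover have "v \<in> Z_combs (gen ` {1..d + 4})"
    unfolding lin_combs_gen[OF d] v_def c_def by auto
  ultimately have "v \<in> N_combs (gen ` \<sigma>)" using hilb[OF \<sigma>] v\<sigma> by auto
  then obtain r where r: "v = comb d r" "\<forall>i\<in>{1..d + 4}. r i \<in> \<nat>" "\<forall>i. i \<notin> \<sigma> \<longrightarrow> r i = 0"
    unfolding lin_combs_subset_gen[OF d sub Nats_0] by blast
  \<comment> \<open>Outside the index range \<open>r\<close> vanishes, so it is natural everywhere
    and comes from a total function \<open>m\<close>.\<close>
  have "\<forall>i. r i \<in> \<nat>" using r sub by (metis Nats_0 subsetD)
  then obtain m where m: "r = (\<lambda>i. real (m i))"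
    by (metis Nats_cases)
  \<comment> \<open>Comparing the two representations of \<open>v\<close> coordinatewise yields the
    constants 4 and 9, and coefficient 1 for every free unit vector.\<close>
  note l = arg_cong[OF r(1), of "\<lambda>x. Poly_Mapping.lookup x k" for k, unfolded v_def lookup_comb[OF d] m]
  have eq: "real (m 1 + (m 10 + m 7)) = real (4 + m 6)" "real (m 2 + (m 6 + m 8)) = real (4 + m 7)"
    "real (m 3 + (m 7 + m 9)) = real (4 + m 8)" "real (m 4 + (m 8 + m 10)) = real (4 + m 9)"
    "real (m 5 + (m 9 + m 6)) = real (4 + m 10)" "real (m 6 + m 7 + m 8 + m 9 + m 10) = real 9"
    subgoal using l[of 1] by (simp add: c_def)
    subgoal using l[of 2] by (simp add: c_def)
    subgoal using l[of 3] by (simp add: c_def)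
    subgoal using l[of 4] by (simp add: c_def)
    subgoal using l[of 5] by (simp add: c_def)
    subgoal using l[of 6] by (simp add: c_def)
    done
  have "6 < card {i\<in>{1..10}. m i \<noteq> 0}"
    by (rule seven_generators[OF eq[unfolded of_nat_eq_iff]])
  moreover have "{i\<in>{1..10}. m i \<noteq> 0} \<union> {11..d + 4} \<subseteq> \<sigma>"
  proof -
    have nonzero: "m i \<noteq> 0" if "i \<in> {11..d + 4}" for i
    proof -
      from that have "i = (i - 11) + 11" by simp
      then obtain k where "i = k + 11" by blast
      moreover from this have "real (m (k + 11)) = 1"
        using l[of "k + 7"] that by (simp add: c_def add.commute)
      ultimately show ?thesis by simp
    qed
    have "i \<in> \<sigma>" if "m i \<noteq> 0" for i
      using r(3)[rule_format, of i] that unfolding m of_nat_eq_0_iff by blast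
    with nonzero show ?thesis by blast
  qed
  then have "card ({i\<in>{1..10}. m i \<noteq> 0} \<union> {11..d + 4}) \<le> d"
    using card_mono[OF finite_subset[OF sub finite_atLeastAtMost]] card by fastforce
  moreover have "card ({i\<in>{1..10}. m i \<noteq> 0} \<union> {11..d + 4}) = card {i\<in>{1..10}. m i \<noteq> 0} + (d - 6)"
    by (subst card_Un_disjoint) auto
  ultimately show False using d by simp
qed

theorem theorem5p7:
  shows "\<exists>(n :: nat \<Rightarrow> nat) (a :: nat \<Rightarrow> nat \<Rightarrow> nat \<Rightarrow>\<^sub>0 real).
    \<forall>d\<ge>11.
      vector_config d (n d) (a d) \<and>
      config_dim (n d) (a d) = d \<and>
      normal_config (n d) (a d) \<and>
      graded_config d (n d) (a d) \<and>
      (\<forall>\<Delta>. regular_triangulation TYPE('k::field) d (n d) (a d) \<Delta> \<longrightarrow>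
            \<not> delta_normal TYPE('k) d (n d) (a d) \<Delta>)"
  \<comment> \<open>The sequence \<open>gen\<close> is the same in all dimensions; only the number
    of terms taken from it varies.\<close>
  by (rule exI[of _ "\<lambda>d. d + 4"], rule exI[of _ "\<lambda>d. gen"])
    (simp add: vector_config_gen config_dim_gen normal_config_gen graded_config_gen gen_not_delta_normal)

end
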